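(* Let $T>0$, let $n\ge 1$ be an integer, and let $u\in C^{n+1}([0,T])$ be real-valued. If $\alpha=n$, then for $t\in(0,T]$ $${}_0^{TC}D_t^n u(t)=u^{(n)}(t)-u^{(n)}(0).$$
   Context: The transformative (T-Caputo) derivative is defined by $${}_0^{TC}D_t^\alpha u(t)=\frac{1}{\Gamma(n+1-\alpha)}\int_0^t u^{(n+1)}(s)(t-s)^{n-\alpha}\,ds,\qquad n-1<\alpha<n,$$ and the same formula (with the same $n$) is used as its definition when $\alpha=n$. Here $\Gamma$ is the Gamma function. *)

theory Defs
  imports "HOL-Analysis.Analysis"
begin

text \<open>
  Derivatives on a closed interval \<open>S\<close> are taken within \<open>S\<close>, so they are one-sided at the
  endpoints and depend only on the values of the function on \<open>S\<close>.
\<close>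

definition nth_deriv_on :: "real set \<Rightarrow> nat \<Rightarrow> (real \<Rightarrow> real) \<Rightarrow> real \<Rightarrow> real" where
  "nth_deriv_on S k u = ((\<lambda>f x. vector_derivative f (at x within S)) ^^ k) u"

definition Ck_on :: "nat \<Rightarrow> real set \<Rightarrow> (real \<Rightarrow> real) \<Rightarrow> bool" where
  "Ck_on k S u \<longleftrightarrow>
     (\<forall>j<k. nth_deriv_on S j u differentiable_on S) \<and> continuous_on S (nth_deriv_on S k u)"

text \<open>
  The transformative (T-Caputo) derivative of order \<open>\<alpha> > 0\<close> of a function on \<open>{0..T}\<close>.
  The integer \<open>n\<close> with \<open>n - 1 < \<alpha> \<le> n\<close> is the ceiling of \<open>\<alpha>\<close>; the case \<open>\<alpha> = n\<close> is included.
  For \<open>\<alpha> = n\<close> the kernel is \<open>(t - s) powr 0\<close>, which is \<open>1\<close> for \<open>s < t\<close>; the convention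
  \<open>0 powr 0 = 0\<close> only affects the single point \<open>s = t\<close> and hence not the integral.
\<close>

definition t_caputo :: "real \<Rightarrow> real \<Rightarrow> (real \<Rightarrow> real) \<Rightarrow> real \<Rightarrow> real" where
  "t_caputo T \<alpha> u t =
     (let n = nat \<lceil>\<alpha>\<rceil> in
        1 / Gamma (real n + 1 - \<alpha>) *
        integral {0..t} (\<lambda>s. nth_deriv_on {0..T} (n + 1) u s * (t - s) powr (real n - \<alpha>)))"

end

theory Submission
  imports Defs
begin

text \<open>At \<open>\<alpha> = n\<close> the factor is 1 / Gamma 1 = 1 and the kernel is 1 except
  at \<open>s = t\<close>, so only the integral of the derivative of order n + 1 over [0,t] remains.
  The fundamental theorem of calculus evaluates it; \<open>Ck_on_Suc_has_vector_derivative\<close>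
  supplies the antiderivative.\<close>

lemma nth_deriv_on_Suc:
  "nth_deriv_on S (Suc k) u x = vector_derivative (nth_deriv_on S k u) (at x within S)"
  by (simp add: nth_deriv_on_def)

lemma Ck_on_Suc_has_vector_derivative:
  assumes "Ck_on (Suc k) S u" "x \<in> S"
  shows "(nth_deriv_on S k u has_vector_derivative nth_deriv_on S (Suc k) u x) (at x within S)"
  using assms by (simp add: Ck_on_def differentiable_on_def nth_deriv_on_Suc
      flip: vector_derivative_works)

theorem lemma6:
  fixes T \<alpha> t :: real and n :: nat and u :: "real \<Rightarrow> real"
  assumes "T > 0"
    and "n \<ge> 1"
    and "Ck_on (n + 1) {0..T} u"
    and "\<alpha> = real n"
    and "t \<in> {0<..T}"
  shows "t_caputo T \<alpha> u t = nth_deriv_on {0..T} n u t - nth_deriv_on {0..T} n u 0"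
proof -
  let ?v = "nth_deriv_on {0..T} (Suc n) u"
  \<comment> \<open>Derivatives within \<open>{0..T}\<close> remain derivatives within the subset
    \<open>{0..t}\<close>, even at \<open>s = t\<close>.\<close>
  have "(nth_deriv_on {0..T} n u has_vector_derivative ?v s) (at s within {0..t})"
    if "s \<in> {0..t}" for s
    using Ck_on_Suc_has_vector_derivative[of n "{0..T}" u s] assms that
    by (auto intro: has_vector_derivative_within_subset)
  then have "(?v has_integral nth_deriv_on {0..T} n u t - nth_deriv_on {0..T} n u 0) {0..t}"
    using assms by (intro fundamental_theorem_of_calculus) auto
  \<comment> \<open>As \<open>0 powr 0 = 0\<close>, the integrands may differ at
    \<open>s = t\<close>, a null set.\<close>
  moreover have "integral {0..t} (\<lambda>s. ?v s * (t - s) powr 0) = integral {0..t} ?v"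
    by (rule integral_spike[of "{t}"]) auto
  ultimately show ?thesis
    using assms by (simp add: t_caputo_def integral_unique del: powr_zero_eq_one)
qed

end
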